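(* Let $t\ge 1$ and $\nu$ be integers with $0\le \nu\le t$, and let $n=T_t+\nu$, where $T_t=\frac{t(t+1)}{2}$. Then the maximal degree $\Delta_n$ of the partition graph $G_n$ is \[ \Delta_n=t(t-1)+\beta_t(\nu). \] Equivalently, if $q=\lfloor\sqrt{\nu}\rfloor$, then \[ \Delta_{T_t+\nu}=\begin{cases}t(t-1), & \nu=0,\\ t(t-1)+2q-1, & q^2\le \nu<q(q+1),\\ t(t-1)+2q, & q(q+1)\le \nu<(q+1)^2.\end{cases} \]
   Context: A partition $\lambda\vdash n$ is a finite nonincreasing sequence of positive integers with sum $n$. The partition graph $G_n$ ($n\ge 1$) is the simple graph whose vertices are the partitions of $n$; two distinct partitions are adjacent if one is obtained from the other by an elementary transfer of one unit between two parts, followed by reordering: one part is decreased by $1$ and another part is increased by $1$. Here the receiving part may be an empty part of size $0$ (so that a new part $1$ is created), and a part that becomes $0$ is discarded. $\deg(\lambda)$ denotes the degree of the vertex $\lambda$ in $G_n$, and $\Delta_n:=\max_{\lambda\vdash n}\deg(\lambda)$. For integers $r\ge 1$ and $s\ge 0$, $\beta_r(s)$ denotes the maximal cardinality of a submultiset of the multiset $\{1,1,2,2,\dots,r,r\}$ (two copies of each integer from $1$ to $r$) whose total weight (sum of elements) is at most $s$. *)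

theory Defs
  imports Complex_Main "HOL-Library.Multiset"
begin

definition partitions :: "nat \<Rightarrow> nat multiset set" where
  "partitions n = {\<kappa>. 0 \<notin># \<kappa> \<and> sum_mset \<kappa> = n}"

text \<open>
  The donor \<open>a\<close> and the receiver \<open>b\<close> are two different parts, possibly of equal size, hence the
  submultiset condition. The extra part \<open>0\<close> is the empty part that may receive the unit.
\<close>

definition transfer :: "nat multiset \<Rightarrow> nat multiset \<Rightarrow> bool" where
  "transfer \<kappa> \<mu> \<longleftrightarrow>
     (\<exists>a b. a > 0 \<and> {#a, b#} \<subseteq># add_mset 0 \<kappa> \<and>
        \<mu> = filter_mset (\<lambda>x. x > 0) (add_mset 0 \<kappa> - {#a, b#} + {#a - 1, b + 1#}))"

definition adjacent :: "nat multiset \<Rightarrow> nat multiset \<Rightarrow> bool" where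
  "adjacent \<kappa> \<mu> \<longleftrightarrow> \<kappa> \<noteq> \<mu> \<and> (transfer \<kappa> \<mu> \<or> transfer \<mu> \<kappa>)"

definition partition_degree :: "nat \<Rightarrow> nat multiset \<Rightarrow> nat" where
  "partition_degree n \<kappa> = card {\<mu> \<in> partitions n. adjacent \<kappa> \<mu>}"

definition max_degree :: "nat \<Rightarrow> nat" where
  "max_degree n = Max (partition_degree n ` partitions n)"

definition beta :: "nat \<Rightarrow> nat \<Rightarrow> nat" where
  "beta r s = Max (size ` {M. M \<subseteq># repeat_mset 2 (mset_set {1..r}) \<and> sum_mset M \<le> s})"

text \<open>The sets whose cardinality or maximum is taken above are finite, and nonempty for the maxima.\<close>

lemma finite_submultisets: "finite {M. M \<subseteq># (A :: 'a multiset)}"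
proof (induction A)
  case empty
  show ?case by simp
next
  case (add x A)
  have "M \<in> {M. M \<subseteq># A} \<union> add_mset x ` {M. M \<subseteq># A}" if "M \<subseteq># add_mset x A" for M
  proof (cases "x \<in># M")
    case True
    then have "M = add_mset x (M - {#x#})" by simp
    moreover have "M - {#x#} \<subseteq># A" using that by (simp add: subset_eq_diff_conv)
    ultimately show ?thesis by blast
  next
    case False
    then have "M \<subseteq># A"
      using that unfolding subseteq_mset_def by (metis count_add_mset not_in_iff zero_le)
    then show ?thesis by blast
  qed
  then have "{M. M \<subseteq># add_mset x A} \<subseteq> {M. M \<subseteq># A} \<union> add_mset x ` {M. M \<subseteq># A}" by blast
  then show ?case using add by (meson finite_UnI finite_imageI finite_subset)
qed

lemma count_le_sum_mset:
  assumes "0 \<notin># (M :: nat multiset)"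
  shows "count M x \<le> sum_mset M"
  using assms by (induction M) auto

lemma finite_partitions: "finite (partitions n)"
proof (rule finite_subset)
  show "partitions n \<subseteq> {M. M \<subseteq># repeat_mset n (mset_set {1..n})}"
  proof
    fix M assume "M \<in> partitions n"
    then have M: "0 \<notin># M" "sum_mset M = n" by (auto simp: partitions_def)
    have "count M x \<le> count (repeat_mset n (mset_set {1..n})) x" for x
    proof (cases "x \<in># M")
      case True
      then have "x \<noteq> 0" "x \<le> n" using M by (auto dest!: multi_member_split)
      then show ?thesis using count_le_sum_mset[of M x] M by simp
    next
      case False
      then show ?thesis by (simp add: not_in_iff)
    qed
    then show "M \<in> {M. M \<subseteq># repeat_mset n (mset_set {1..n})}" by (simp add: subseteq_mset_def)
  qed
qed (rule finite_submultisets)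

lemma partitions_nonempty: "partitions n \<noteq> {}"
proof -
  have "replicate_mset n 1 \<in> partitions n"
    by (auto simp: partitions_def)
  then show ?thesis by blast
qed

lemma finite_beta: "finite {M. M \<subseteq># repeat_mset 2 (mset_set {1..r}) \<and> sum_mset M \<le> (s::nat)}"
  by (rule finite_subset[OF _ finite_submultisets]) auto

lemma beta_nonempty: "{M. M \<subseteq># repeat_mset 2 (mset_set {1..r}) \<and> sum_mset M \<le> (s::nat)} \<noteq> {}"
  by (auto intro: exI[of _ "{#}"])

end

theory Submission
  imports Defs
begin

text \<open>
  Let \<open>\<kappa>\<close> be a partition of \<open>n\<close> with \<open>k\<close> distinct part sizes. Call a part size \<open>a \<ge> 2\<close> a gap if
  \<open>a - 1\<close> is not a part size; let \<open>g\<close> be the number of gaps and \<open>r\<close> the number of part sizes that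
  occur at least twice. A transfer from a part of size \<open>a\<close> to a part of size \<open>b\<close> lowers by one the
  number of parts that are at least \<open>a\<close>, raises by one the number of parts that are at least
  \<open>b + 1\<close>, and changes none of the other numbers of this kind. Hence the neighbours of \<open>\<kappa>\<close>
  correspond bijectively to the pairs \<open>(a, b)\<close> of sizes with \<open>a \<noteq> b + 1\<close> for which the transfer is
  possible, and counting these pairs gives \<open>deg \<kappa> = k (k - 1) + g + r\<close>
  (\<open>partition_degree_eq\<close>).

  Write \<open>T\<^sub>m\<close> for the \<open>m\<close>-th triangular number. The part sizes add up to at least \<open>T\<^sub>k + T\<^sub>g\<close>, because
  the largest of them exceeds \<open>k\<close> by at least the number of gaps (\<open>tri_card_gaps_le_sum\<close>); the
  second copies of repeated sizes add at least \<open>T\<^sub>r\<close>. So \<open>T\<^sub>k + T\<^sub>g + T\<^sub>r \<le> n = T\<^sub>t + \<nu>\<close>, and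
  \<open>k \<le> t\<close> because \<open>\<nu> \<le> t\<close>. If \<open>k < t\<close>, then \<open>g, r \<le> k\<close> gives \<open>deg \<kappa> \<le> k (k + 1) \<le> t (t - 1)\<close>.
  If \<open>k = t\<close>, then \<open>T\<^sub>g + T\<^sub>r \<le> \<nu>\<close>, which bounds \<open>g + r\<close> by convexity: the best choice under this
  constraint is a balanced pair \<open>(q, p)\<close> with \<open>p \<in> {q - 1, q}\<close> (\<open>balanced_pair_max\<close>).

  The same bound computes \<open>beta t \<nu> = q + p\<close>, since a multiset with multiplicities at most two is a
  pair of sets (\<open>beta_eq\<close>). The bound on the degree is attained by the staircase \<open>1, \<dots>, t\<close> whose
  last \<open>q\<close> steps are widened to \<open>2\<close>, whose parts \<open>1, \<dots>, p\<close> are doubled, and whose largest part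
  absorbs the rest (\<open>exists_partition_of_degree\<close>).
\<close>

section \<open>Triangular numbers\<close>

text \<open>The triangular number \<open>1 + 2 + \<dots> + n\<close>.\<close>
definition tri :: "nat \<Rightarrow> nat" where
  "tri n = n * (n + 1) div 2"

lemma double_tri: "2 * tri n = n * (n + 1)"
  by (simp add: tri_def)

lemma tri_0 [simp]: "tri 0 = 0"
  by (simp add: tri_def)

lemma tri_Suc [simp]: "tri (Suc n) = tri n + Suc n"
  using double_tri[of n] double_tri[of "Suc n"] by (simp add: algebra_simps)

lemma tri_mono: "m \<le> n \<Longrightarrow> tri m \<le> tri n"
  unfolding tri_def by (intro div_le_mono mult_le_mono) auto

lemma sum_atLeastAtMost_eq_tri: "\<Sum>{1..n} = tri n"
  by (induction n) auto

lemma sum_diff_eq_tri: "(\<Sum>i = 1..m + q. i - m) = tri q"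
proof (induction q)
  case 0
  then show ?case by simp
next
  case (Suc q)
  have "(\<Sum>i = 1..m + Suc q. i - m) = (\<Sum>i = 1..m + q. i - m) + Suc q" by simp
  with Suc show ?case by simp
qed

text \<open>An upper bound for \<open>g + r\<close> under the constraint \<open>T\<^sub>g + T\<^sub>r \<le> \<nu>\<close>. If \<open>g + r \<ge> m\<close>, then
  \<open>T\<^sub>g + T\<^sub>r \<ge> m (m + 2) / 4\<close>; the first hypothesis says that \<open>\<nu>\<close> is too small for this with
  \<open>m = q + p + 1\<close>.\<close>
lemma balanced_pair_max:
  assumes "4 * \<nu> < (q + p + 1) * (q + p + 3)" and "tri g + tri r \<le> \<nu>"
  shows "g + r \<le> q + p"
proof (rule ccontr)
  assume "\<not> g + r \<le> q + p"
  then have "(q + p + 1) * (q + p + 3) \<le> (g + r) * (g + r + 2)"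
    by (intro mult_le_mono) auto
  also have "\<dots> \<le> 2 * (g * (g + 1) + r * (r + 1))"
  proof -
    have "0 \<le> (int g - int r)\<^sup>2" by simp
    then have "int ((g + r) * (g + r + 2)) \<le> int (2 * (g * (g + 1) + r * (r + 1)))"
      by (simp add: power2_eq_square algebra_simps)
    then show ?thesis by (simp only: of_nat_le_iff)
  qed
  also have "\<dots> = 4 * (tri g + tri r)"
    using double_tri[of g] double_tri[of r] by simp
  also have "\<dots> \<le> 4 * \<nu>" using assms(2) by simp
  also have "\<dots> < (q + p + 1) * (q + p + 3)" by (rule assms(1))
  finally show False by simp
qed

section \<open>Gaps in a finite set of positive integers\<close>

text \<open>Elements \<open>a \<ge> 2\<close> without predecessor in the set. The element \<open>1\<close> never counts as a gap,
  because its predecessor \<open>0\<close> stands for the empty part, which is always present.\<close>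
definition gaps :: "nat set \<Rightarrow> nat set" where
  "gaps D = {a \<in> D. 2 \<le> a \<and> a - 1 \<notin> D}"

lemma gaps_subset: "gaps D \<subseteq> D"
  by (auto simp: gaps_def)

lemma finite_gaps: "finite D \<Longrightarrow> finite (gaps D)"
  using gaps_subset finite_subset by blast

text \<open>The predecessors of gaps are distinct positive integers outside \<open>D\<close>.\<close>
lemma card_gaps_le_bound:
  assumes "D \<subseteq> {1..m}"
  shows "card D + card (gaps D) \<le> m"
proof -
  have fin: "finite D" using assms finite_subset by blast
  have inj: "inj_on (\<lambda>a. a - 1) (gaps D)"
    by (auto simp: inj_on_def gaps_def)
  have "card D + card (gaps D) = card D + card ((\<lambda>a. a - 1) ` gaps D)"
    by (simp only: card_image[OF inj])
  also have "\<dots> = card (D \<union> (\<lambda>a. a - 1) ` gaps D)"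
    by (rule card_Un_disjoint[symmetric]) (use fin finite_gaps in \<open>auto simp: gaps_def\<close>)
  also have "\<dots> \<le> card {1..m}"
  proof (rule card_mono)
    have "a - 1 \<in> {1..m}" if "a \<in> gaps D" for a
      using that subsetD[OF assms, of a] by (auto simp: gaps_def)
    then show "D \<union> (\<lambda>a. a - 1) ` gaps D \<subseteq> {1..m}" using assms by blast
  qed simp
  finally show ?thesis by simp
qed

lemma tri_card_gaps_le_sum:
  assumes "finite D" and "0 \<notin> D"
  shows "tri (card D) + tri (card (gaps D)) \<le> \<Sum>D"
  using assms
proof (induction D rule: finite_linorder_max_induct)
  case empty
  show ?case by (simp add: gaps_def)
next
  case (insert m D)
  have m: "m \<notin> D" using insert by blast
  have le: "card (insert m D) + card (gaps (insert m D)) \<le> m"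
  proof (rule card_gaps_le_bound)
    have "1 \<le> x \<and> x \<le> m" if "x \<in> insert m D" for x
      using that insert.hyps(2) insert.prems by (cases x) (auto simp: less_imp_le)
    then show "insert m D \<subseteq> {1..m}" by auto
  qed
  have "gaps (insert m D) \<subseteq> insert m (gaps D)" by (auto simp: gaps_def)
  then have "card (gaps (insert m D)) \<le> card (insert m (gaps D))"
    using finite_gaps[OF insert.hyps(1)] by (intro card_mono) simp_all
  also have "\<dots> \<le> Suc (card (gaps D))" by (rule card_insert_le_m1) simp_all
  finally have "card (gaps (insert m D)) \<le> Suc (card (gaps D))" .
  then consider "card (gaps (insert m D)) \<le> card (gaps D)"
    | "card (gaps (insert m D)) = Suc (card (gaps D))" by linarith
  then have "tri (card (insert m D)) + tri (card (gaps (insert m D)))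
      \<le> tri (card D) + tri (card (gaps D)) + m"
  proof cases
    case 1
    then show ?thesis using tri_mono[OF 1] le m insert.hyps(1) by simp
  next
    case 2
    then show ?thesis using le m insert.hyps(1) by simp
  qed
  moreover have "tri (card D) + tri (card (gaps D)) \<le> \<Sum>D"
    using insert.IH insert.prems by simp
  moreover have "\<Sum>(insert m D) = m + \<Sum>D"
    using m insert.hyps(1) by simp
  ultimately show ?case by linarith
qed

lemma tri_card_le_sum:
  assumes "finite D" and "0 \<notin> D"
  shows "tri (card D) \<le> \<Sum>D"
  using tri_card_gaps_le_sum[OF assms] by simp

section \<open>Repeated elements of a multiset\<close>

text \<open>The set of elements that occur at least twice.\<close>
definition repeated :: "'a multiset \<Rightarrow> 'a set" where
  "repeated M = {a. 2 \<le> count M a}"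

lemma repeated_subset: "repeated M \<subseteq> set_mset M"
proof
  fix x assume "x \<in> repeated M"
  then have "count M x \<noteq> 0" by (simp add: repeated_def)
  then show "x \<in> set_mset M" by (simp only: count_eq_zero_iff not_not)
qed

lemma finite_repeated: "finite (repeated M)"
  using repeated_subset finite_subset finite_set_mset by metis

lemma count_set_repeated:
  "count (mset_set (set_mset M) + mset_set (repeated M)) x = min 2 (count M x)"
proof -
  have "count (mset_set (set_mset M)) x = (if count M x = 0 then 0 else 1)"
    by (simp add: count_mset_set')
  moreover have "count (mset_set (repeated M)) x = (if 2 \<le> count M x then 1 else 0)"
    using finite_repeated[of M] unfolding count_mset_set' by (simp add: repeated_def)
  ultimately show ?thesis unfolding count_union min_def by presburger
qed

lemma sum_mset_mset_set_eq_Sum: "sum_mset (mset_set A) = \<Sum>A"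
  by (simp add: sum_unfold_sum_mset)

lemma sum_set_repeated_le: "\<Sum>(set_mset M) + \<Sum>(repeated M) \<le> sum_mset (M :: nat multiset)"
proof -
  have "mset_set (set_mset M) + mset_set (repeated M) \<subseteq># M"
    by (rule mset_subset_eqI) (simp only: count_set_repeated min.cobounded2)
  then obtain C where C: "M = mset_set (set_mset M) + mset_set (repeated M) + C"
    unfolding mset_subset_eq_exists_conv by blast
  have "sum_mset M = \<Sum>(set_mset M) + \<Sum>(repeated M) + sum_mset C"
    by (subst C) (simp only: sum_mset.union sum_mset_mset_set_eq_Sum)
  then show ?thesis by linarith
qed

lemma size_eq_card_set_repeated:
  assumes "\<And>x. count M x \<le> 2"
  shows "size M = card (set_mset M) + card (repeated M)"
proof -
  have "M = mset_set (set_mset M) + mset_set (repeated M)"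
    by (rule multiset_eqI) (simp only: count_set_repeated min_absorb2 assms)
  then have "size M = size (mset_set (set_mset M) + mset_set (repeated M))" by (rule arg_cong)
  then show ?thesis by simp
qed

lemma tri_bound:
  assumes "0 \<notin># M"
  shows "tri (card (set_mset M)) + tri (card (gaps (set_mset M))) + tri (card (repeated M))
    \<le> sum_mset M"
proof -
  have "0 \<notin> repeated M" using assms subsetD[OF repeated_subset, of 0 M] by blast
  then have "tri (card (repeated M)) \<le> \<Sum>(repeated M)"
    by (rule tri_card_le_sum[OF finite_repeated])
  with tri_card_gaps_le_sum[OF finite_set_mset assms] sum_set_repeated_le[of M]
  show ?thesis by linarith
qed

section \<open>The function beta\<close>

lemma beta_eq:
  assumes "q \<le> t" "p \<le> t" "tri q + tri p \<le> \<nu>" "4 * \<nu> < (q + p + 1) * (q + p + 3)"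
  shows "beta t \<nu> = q + p"
  unfolding beta_def
proof (rule Max_eqI)
  show "finite (size ` {M. M \<subseteq># repeat_mset 2 (mset_set {1..t}) \<and> sum_mset M \<le> \<nu>})"
    using finite_beta by simp
next
  fix y assume "y \<in> size ` {M. M \<subseteq># repeat_mset 2 (mset_set {1..t}) \<and> sum_mset M \<le> \<nu>}"
  then obtain M where M: "M \<subseteq># repeat_mset 2 (mset_set {1..t})" "sum_mset M \<le> \<nu>" "y = size M"
    by auto
  have cnt: "count M x \<le> 2 * count (mset_set {1..t}) x" for x
    using mset_subset_eq_count[OF M(1), of x] by simp
  have "count M x \<le> 2" for x
    using cnt[of x] by (auto simp: count_mset_set' split: if_splits)
  then have y: "y = card (set_mset M) + card (repeated M)"
    unfolding M(3) by (rule size_eq_card_set_repeated)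
  have "0 \<notin># M"
    using cnt[of 0] by (simp add: not_in_iff)
  then have "tri (card (set_mset M)) + tri (card (repeated M)) \<le> \<nu>"
    using tri_bound[of M] M(2) by linarith
  then show "y \<le> q + p"
    unfolding y by (rule balanced_pair_max[OF assms(4)])
next
  let ?M = "mset_set {1..q} + mset_set {1..p}"
  have "?M \<subseteq># repeat_mset 2 (mset_set {1..t})"
    using assms(1,2) by (auto intro!: mset_subset_eqI simp: count_mset_set')
  moreover have "sum_mset ?M = tri q + tri p"
    by (simp only: sum_mset.union sum_mset_mset_set_eq_Sum sum_atLeastAtMost_eq_tri)
  ultimately show "q + p \<in> size ` {M. M \<subseteq># repeat_mset 2 (mset_set {1..t}) \<and> sum_mset M \<le> \<nu>}"
    using assms(3) by (intro image_eqI[of _ _ ?M]) auto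
qed

section \<open>The degree of a partition\<close>

text \<open>The result of moving one unit from a part \<open>a\<close> to a part \<open>b\<close>, where \<open>b = 0\<close> stands for the
  empty part.\<close>
definition move :: "nat multiset \<Rightarrow> nat \<times> nat \<Rightarrow> nat multiset" where
  "move \<kappa> = (\<lambda>(a, b). filter_mset (\<lambda>x. x > 0) (add_mset 0 \<kappa> - {#a, b#} + {#a - 1, b + 1#}))"

text \<open>The pairs (donor size, receiver size) that define a transfer changing the partition.\<close>
definition moves :: "nat multiset \<Rightarrow> (nat \<times> nat) set" where
  "moves \<kappa> = {(a, b). a > 0 \<and> {#a, b#} \<subseteq># add_mset 0 \<kappa> \<and> a \<noteq> b + 1}"

lemma filter_pos_ident: "0 \<notin># (M :: nat multiset) \<Longrightarrow> filter_mset (\<lambda>x. x > 0) M = M"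
  by (metis filter_mset_cong filter_mset_True gr0I)

text \<open>The number of parts of size at least \<open>j\<close>, that is, the \<open>j\<close>-th part of the conjugate.\<close>
definition conj_part :: "nat multiset \<Rightarrow> nat \<Rightarrow> nat" where
  "conj_part M j = size (filter_mset (\<lambda>x. j \<le> x) M)"

lemma conj_part_filter_pos:
  assumes "j > 0"
  shows "conj_part (filter_mset (\<lambda>x. x > 0) M) j = conj_part M j"
proof -
  have "filter_mset (\<lambda>x. j \<le> x) (filter_mset (\<lambda>x. x > 0) M) = filter_mset (\<lambda>x. j \<le> x) M"
    unfolding filter_filter_mset by (rule filter_mset_cong) (use assms in auto)
  then show ?thesis by (simp add: conj_part_def)
qed

lemma conj_part_move:
  assumes "a > 0" "{#a, b#} \<subseteq># add_mset 0 \<kappa>" "j > 0"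
  shows "conj_part (move \<kappa> (a, b)) j + (if j = a then 1 else 0)
    = conj_part \<kappa> j + (if j = b + 1 then 1 else 0)"
proof -
  obtain C where C: "add_mset 0 \<kappa> = {#a, b#} + C"
    using assms(2) by (metis subset_mset.add_diff_inverse)
  have "conj_part (move \<kappa> (a, b)) j = conj_part (C + {#a - 1, b + 1#}) j"
    unfolding move_def prod.case C by (simp only: conj_part_filter_pos[OF assms(3)] add_diff_cancel_left')
  moreover have "conj_part \<kappa> j = conj_part ({#a, b#} + C) j"
    using assms(3) unfolding C[symmetric] by (simp add: conj_part_def)
  ultimately show ?thesis
    using assms(1) by (auto simp: conj_part_def)
qed

lemma move_neq:
  assumes "(a, b) \<in> moves \<kappa>"
  shows "move \<kappa> (a, b) \<noteq> \<kappa>"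
  using conj_part_move[of a b \<kappa> a] assms by (auto simp: moves_def)

lemma inj_on_move: "inj_on (move \<kappa>) (moves \<kappa>)"
proof (rule inj_onI, clarify)
  fix a b c d
  assume ab: "(a, b) \<in> moves \<kappa>" and cd: "(c, d) \<in> moves \<kappa>" and eq: "move \<kappa> (a, b) = move \<kappa> (c, d)"
  have *: "(if j = b + 1 then 1 else 0) + (if j = c then 1 else 0)
      = (if j = d + 1 then 1 else 0) + (if j = a then 1 else (0::nat))" if "j > 0" for j
    using conj_part_move[of a b \<kappa> j] conj_part_move[of c d \<kappa> j] ab cd eq that
    by (auto simp: moves_def split: if_splits)
  show "a = c \<and> b = d"
    using *[of a] *[of "b + 1"] ab cd by (auto simp: moves_def split: if_splits)
qed

lemma move_eq_self:
  assumes "0 \<notin># \<kappa>" "{#b + 1, b#} \<subseteq># add_mset 0 \<kappa>"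
  shows "move \<kappa> (b + 1, b) = \<kappa>"
proof -
  have "add_mset 0 \<kappa> - {#b + 1, b#} + {#b + 1 - 1, b + 1#} = add_mset 0 \<kappa>"
    using subset_mset.diff_add[OF assms(2)] by (simp add: add_mset_commute)
  then have "move \<kappa> (b + 1, b) = filter_mset (\<lambda>x. x > 0) (add_mset 0 \<kappa>)"
    unfolding move_def prod.case by (rule arg_cong)
  then show ?thesis
    using filter_pos_ident[OF assms(1)] by simp
qed

lemma transfer_neq_iff:
  assumes "0 \<notin># \<kappa>"
  shows "transfer \<kappa> \<mu> \<and> \<kappa> \<noteq> \<mu> \<longleftrightarrow> \<mu> \<in> move \<kappa> ` moves \<kappa>"
proof
  assume *: "transfer \<kappa> \<mu> \<and> \<kappa> \<noteq> \<mu>"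
  then obtain a b where ab: "a > 0" "{#a, b#} \<subseteq># add_mset 0 \<kappa>" "\<mu> = move \<kappa> (a, b)"
    by (auto simp: transfer_def move_def)
  then have "(a, b) \<in> moves \<kappa>"
    using * move_eq_self[OF assms, of b] by (auto simp: moves_def)
  then show "\<mu> \<in> move \<kappa> ` moves \<kappa>" using ab(3) by blast
next
  assume "\<mu> \<in> move \<kappa> ` moves \<kappa>"
  then obtain a b where ab: "(a, b) \<in> moves \<kappa>" "\<mu> = move \<kappa> (a, b)" by auto
  have "a > 0" "{#a, b#} \<subseteq># add_mset 0 \<kappa>" using ab(1) by (simp_all add: moves_def)
  then have "transfer \<kappa> \<mu>" unfolding ab(2) transfer_def move_def prod.case by blast
  moreover have "\<kappa> \<noteq> \<mu>" using move_neq[OF ab(1)] unfolding ab(2) by (rule not_sym)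
  ultimately show "transfer \<kappa> \<mu> \<and> \<kappa> \<noteq> \<mu>" by blast
qed

text \<open>The transfer from \<open>b + 1\<close> to \<open>a - 1\<close> undoes the transfer from \<open>a\<close> to \<open>b\<close>.\<close>
lemma transfer_sym:
  assumes "0 \<notin># \<kappa>" "transfer \<kappa> \<mu>"
  shows "transfer \<mu> \<kappa>"
proof -
  let ?pos = "filter_mset (\<lambda>x::nat. x > 0)"
  obtain a b where ab: "a > 0" "{#a, b#} \<subseteq># add_mset 0 \<kappa>"
    "\<mu> = ?pos (add_mset 0 \<kappa> - {#a, b#} + {#a - 1, b + 1#})"
    using assms(2) by (auto simp: transfer_def)
  obtain C where C: "add_mset 0 \<kappa> = {#a, b#} + C"
    using ab(2) by (metis subset_mset.add_diff_inverse)
  \<comment> \<open>\<open>C'\<close> is what the reverse transfer leaves untouched. If \<open>a = 1\<close>, the unit goes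
    back to the empty part; otherwise the empty part is among the untouched ones.\<close>
  define C' where "C' = (if a = 1 then ?pos C else add_mset 0 (?pos C))"
  have \<mu>: "add_mset 0 \<mu> = {#b + 1, a - 1#} + C'"
    using ab(1) unfolding ab(3) C by (auto simp: C'_def)
  have "\<kappa> = ?pos (add_mset 0 \<kappa>)"
    using filter_pos_ident[OF assms(1)] by simp
  also have "\<dots> = ?pos (C' + {#b, a#})"
    unfolding C by (auto simp: C'_def filter_filter_mset)
  finally have "\<kappa> = ?pos (add_mset 0 \<mu> - {#b + 1, a - 1#} + {#(b + 1) - 1, (a - 1) + 1#})"
    unfolding \<mu> using ab(1) by simp
  moreover have "{#b + 1, a - 1#} \<subseteq># add_mset 0 \<mu>" unfolding \<mu> by simp
  moreover have "b + 1 > 0" by simp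
  ultimately have "b + 1 > 0 \<and> {#b + 1, a - 1#} \<subseteq># add_mset 0 \<mu> \<and>
      \<kappa> = ?pos (add_mset 0 \<mu> - {#b + 1, a - 1#} + {#(b + 1) - 1, (a - 1) + 1#})"
    by (intro conjI)
  then show ?thesis
    unfolding transfer_def by - (rule exI[of _ "b + 1"], rule exI[of _ "a - 1"])
qed

lemma sum_mset_filter_pos: "sum_mset (filter_mset (\<lambda>x. x > 0) M) = sum_mset (M :: nat multiset)"
  by (induction M) auto

lemma move_in_partitions:
  assumes "\<kappa> \<in> partitions n" "(a, b) \<in> moves \<kappa>"
  shows "move \<kappa> (a, b) \<in> partitions n"
proof -
  have ab: "a > 0" "{#a, b#} \<subseteq># add_mset 0 \<kappa>" using assms(2) by (auto simp: moves_def)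
  obtain C where C: "add_mset 0 \<kappa> = {#a, b#} + C"
    using ab(2) by (metis subset_mset.add_diff_inverse)
  have "sum_mset (move \<kappa> (a, b)) = a + b + sum_mset C"
    using ab(1) unfolding move_def C by (simp add: sum_mset_filter_pos)
  also have "\<dots> = sum_mset (add_mset 0 \<kappa>)" unfolding C by simp
  finally have "sum_mset (move \<kappa> (a, b)) = n" using assms(1) by (simp add: partitions_def)
  moreover have "0 \<notin># move \<kappa> (a, b)" unfolding move_def prod.case set_mset_filter by simp
  ultimately show ?thesis unfolding partitions_def by blast
qed

lemma partition_degree_eq_card_moves:
  assumes "\<kappa> \<in> partitions n"
  shows "partition_degree n \<kappa> = card (moves \<kappa>)"
proof -
  have \<kappa>: "0 \<notin># \<kappa>" using assms by (simp add: partitions_def)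
  have "{\<mu> \<in> partitions n. adjacent \<kappa> \<mu>} = {\<mu> \<in> partitions n. transfer \<kappa> \<mu> \<and> \<kappa> \<noteq> \<mu>}"
    using transfer_sym by (auto simp: adjacent_def partitions_def)
  also have "\<dots> = move \<kappa> ` moves \<kappa>"
    using transfer_neq_iff[OF \<kappa>] move_in_partitions[OF assms] by auto
  finally show ?thesis
    by (simp add: partition_degree_def card_image[OF inj_on_move])
qed

lemma pair_subset_add_mset_0_iff:
  fixes \<kappa> :: "nat multiset"
  assumes "0 \<notin># \<kappa>" "a > 0"
  shows "{#a, b#} \<subseteq># add_mset 0 \<kappa> \<longleftrightarrow>
    a \<in># \<kappa> \<and> b \<in> insert 0 (set_mset \<kappa>) \<and> (a = b \<longrightarrow> a \<in> repeated \<kappa>)"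
proof (cases "a = b")
  case True
  have "{#a, a#} \<subseteq># add_mset 0 \<kappa> \<longleftrightarrow> 2 \<le> count (add_mset 0 \<kappa>) a"
    by (auto simp: subseteq_mset_def)
  then show ?thesis
    using assms True repeated_subset[of \<kappa>] by (auto simp: repeated_def)
next
  case False
  then have "{#a, b#} \<subseteq># add_mset 0 \<kappa> \<longleftrightarrow> a \<in># add_mset 0 \<kappa> \<and> b \<in># add_mset 0 \<kappa>"
    by (auto simp: insert_subset_eq_iff in_diff_count)
  moreover have "a \<noteq> 0" using assms(2) by simp
  ultimately show ?thesis using assms(1) False by auto
qed

lemma card_Diff_add_card:
  assumes "finite A" "B \<subseteq> A"
  shows "card (A - B) + card B = card A"
  using card_Diff_subset[OF finite_subset[OF assms(2,1)] assms(2)] card_mono[OF assms] by simp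

text \<open>Among the \<open>k (k + 1)\<close> pairs of a donor size and a receiver size, those with \<open>a = b + 1\<close>
  change nothing and are given by the sizes that are not gaps, and those with \<open>a = b\<close> are
  admissible for repeated sizes only. The equation is stated without subtraction.\<close>
lemma card_moves:
  assumes "0 \<notin># \<kappa>"
  shows "card (moves \<kappa>) + card (set_mset \<kappa>)
    = (card (set_mset \<kappa>))\<^sup>2 + card (gaps (set_mset \<kappa>)) + card (repeated \<kappa>)"
proof -
  let ?D = "set_mset \<kappa>" and ?R = "repeated \<kappa>"
  let ?A = "(\<lambda>a. (a, a - 1)) ` (?D - gaps ?D)" and ?B = "(\<lambda>a. (a, a)) ` (?D - ?R)"
  have D: "a > 0" if "a \<in># \<kappa>" for a using assms that by (cases a) auto
  have "moves \<kappa> = ?D \<times> insert 0 ?D - (?A \<union> ?B)"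
  proof -
    have "(a, b) \<in> moves \<kappa> \<longleftrightarrow> (a, b) \<in> ?D \<times> insert 0 ?D - (?A \<union> ?B)" for a b
    proof (cases "a \<in># \<kappa>")
      case True
      have "(a, b) \<in> ?A \<longleftrightarrow> a = b + 1" if "b \<in> insert 0 ?D"
        using that True D[OF True] by (auto simp: gaps_def image_iff)
      then show ?thesis
        using pair_subset_add_mset_0_iff[OF assms D[OF True]] D[OF True] True
        by (auto simp: moves_def)
    next
      case False
      then show ?thesis
        using pair_subset_add_mset_0_iff[OF assms] by (auto simp: moves_def)
    qed
    then show ?thesis by auto
  qed
  moreover have "?A \<union> ?B \<subseteq> ?D \<times> insert 0 ?D"
  proof (intro Un_least image_subsetI SigmaI)
    show "a - 1 \<in> insert 0 ?D" if "a \<in> ?D - gaps ?D" for a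
    proof (cases "2 \<le> a")
      case True
      then show ?thesis using that by (simp add: gaps_def)
    next
      case False
      then have "a - 1 = 0" by simp
      then show ?thesis by simp
    qed
  qed simp_all
  ultimately have "card (moves \<kappa>) + card (?A \<union> ?B) = card (?D \<times> insert 0 ?D)"
    using card_Diff_add_card[of "?D \<times> insert 0 ?D" "?A \<union> ?B"] by simp
  moreover have "card (?A \<union> ?B) = card ?A + card ?B"
  proof (rule card_Un_disjoint)
    have "a - 1 \<noteq> a" if "a \<in> ?D" for a using D[OF that] by simp
    then show "?A \<inter> ?B = {}" by auto
  qed simp_all
  moreover have "card ?A + card (gaps ?D) = card ?D"
  proof -
    have "card ?A = card (?D - gaps ?D)" by (rule card_image) (simp add: inj_on_def)
    then show ?thesis using card_Diff_add_card[OF finite_set_mset gaps_subset] by simp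
  qed
  moreover have "card ?B + card ?R = card ?D"
  proof -
    have "card ?B = card (?D - ?R)" by (rule card_image) (simp add: inj_on_def)
    then show ?thesis using card_Diff_add_card[OF finite_set_mset repeated_subset[of \<kappa>]] by simp
  qed
  moreover have "card (?D \<times> insert 0 ?D) = card ?D * (card ?D + 1)"
    using assms by (simp add: card_cartesian_product)
  ultimately show ?thesis
    by (simp add: power2_eq_square)
qed

lemma partition_degree_eq:
  assumes "\<kappa> \<in> partitions n"
  defines "k \<equiv> card (set_mset \<kappa>)"
  shows "partition_degree n \<kappa> = k * (k - 1) + card (gaps (set_mset \<kappa>)) + card (repeated \<kappa>)"
proof -
  have "k * (k - 1) + k = k\<^sup>2"
    by (cases k) (simp_all add: power2_eq_square)
  then show ?thesis
    using card_moves[of \<kappa>] partition_degree_eq_card_moves[OF assms(1)] assms(1)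
    by (simp add: partitions_def k_def)
qed

section \<open>The maximal degree\<close>

lemma partition_degree_le:
  assumes "\<nu> \<le> t" "4 * \<nu> < (q + p + 1) * (q + p + 3)" "\<kappa> \<in> partitions (tri t + \<nu>)"
  shows "partition_degree (tri t + \<nu>) \<kappa> \<le> t * (t - 1) + (q + p)"
proof -
  let ?D = "set_mset \<kappa>"
  let ?k = "card ?D" and ?g = "card (gaps ?D)" and ?r = "card (repeated \<kappa>)"
  have bound: "tri ?k + tri ?g + tri ?r \<le> tri t + \<nu>"
    using tri_bound[of \<kappa>] assms(3) by (simp add: partitions_def)
  note deg = partition_degree_eq[OF assms(3)]
  have "?k \<le> t"
  proof (rule ccontr)
    assume "\<not> ?k \<le> t"
    then have "tri (Suc t) \<le> tri ?k" by (intro tri_mono) simp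
    then show False using bound assms(1) by simp
  qed
  then consider "?k = t" | "?k < t" by linarith
  then show ?thesis
  proof cases
    case 1
    then have "?g + ?r \<le> q + p"
      using bound by (intro balanced_pair_max[OF assms(2)]) simp
    then show ?thesis using deg 1 by simp
  next
    case 2
    have "?g \<le> ?k" "?r \<le> ?k"
      by (rule card_mono[OF finite_set_mset gaps_subset], rule card_mono[OF finite_set_mset repeated_subset])
    then have "partition_degree (tri t + \<nu>) \<kappa> \<le> ?k * (?k - 1) + 2 * ?k" using deg by simp
    also have "\<dots> = (?k + 1) * ?k" by (cases ?k) auto
    also have "\<dots> \<le> t * (t - 1)" using 2 by (intro mult_le_mono) auto
    finally show ?thesis by simp
  qed
qed

lemma exists_partition_of_degree:
  assumes "t \<ge> 1" "q + p \<le> t" "p \<le> q" "tri q + tri p \<le> \<nu>" "q = 0 \<Longrightarrow> \<nu> = 0"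
  shows "\<exists>\<kappa> \<in> partitions (tri t + \<nu>). t * (t - 1) + (q + p) \<le> partition_degree (tri t + \<nu>) \<kappa>"
proof -
  define m where "m = t - q"
  have t: "t = m + q" using assms(2) by (simp add: m_def)
  define l where "l = \<nu> - (tri q + tri p)"
  \<comment> \<open>The parts in increasing order: the steps at \<open>m + 1, \<dots>, t\<close> have width at least \<open>2\<close>, and the
    largest part takes the remainder \<open>l\<close>. The sizes \<open>1, \<dots>, p\<close> lie below these steps.\<close>
  define f where "f i = i + (i - m) + (if i = t then l else 0)" for i
  have f_step: "f i < f j" if "i < j" "j \<le> t" for i j
    using that by (simp add: f_def)
  have inj: "inj_on f {1..t}"
    by (rule inj_onI) (metis atLeastAtMost_iff f_step linorder_neqE_nat order_less_irrefl)
  define D where "D = f ` {1..t}"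
  define \<kappa> where "\<kappa> = mset_set D + mset_set {1..p}"
  have small: "f i = i" if "i \<le> m" for i
    \<comment> \<open>If \<open>q = 0\<close>, then \<open>m = t\<close>, and the remainder \<open>l\<close> vanishes.\<close>
    using that assms(5) t by (auto simp: f_def l_def)
  have finD: "finite D" and D0: "0 \<notin> D"
    by (auto simp: D_def f_def)
  have cardD: "card D = t"
    unfolding D_def card_image[OF inj] by simp
  have pD: "{1..p} \<subseteq> D"
  proof
    fix i assume i: "i \<in> {1..p}"
    then have "i \<le> m" "i \<in> {1..t}" using assms(2) t by auto
    then show "i \<in> D" unfolding D_def using small[of i] by (metis image_eqI)
  qed
  have set\<kappa>: "set_mset \<kappa> = D" using finD pD by (auto simp: \<kappa>_def)
  have "\<Sum>D = tri t + tri q + l"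
  proof -
    have "\<Sum>D = (\<Sum>i = 1..t. f i)" unfolding D_def sum.reindex[OF inj] by simp
    also have "\<dots> = \<Sum>{1..t} + (\<Sum>i = 1..t. i - m) + (\<Sum>i = 1..t. if i = t then l else 0)"
      by (simp add: f_def sum.distrib)
    also have "(\<Sum>i = 1..t. i - m) = tri q" unfolding t by (rule sum_diff_eq_tri)
    also have "\<Sum>{1..t} = tri t" by (rule sum_atLeastAtMost_eq_tri)
    finally show ?thesis using assms(1) by simp
  qed
  then have "sum_mset \<kappa> = tri t + \<nu>"
    using assms(4)
    by (simp only: \<kappa>_def sum_mset.union sum_mset_mset_set_eq_Sum sum_atLeastAtMost_eq_tri l_def)
  then have part: "\<kappa> \<in> partitions (tri t + \<nu>)"
    using set\<kappa> D0 by (simp add: partitions_def)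
  have "f ` {m + 1..t} \<subseteq> gaps D"
  proof
    fix x assume "x \<in> f ` {m + 1..t}"
    then obtain i where i: "m + 1 \<le> i" "i \<le> t" "x = f i" by auto
    have "f j \<noteq> f i - 1" if "j \<in> {1..t}" for j
    proof (cases "j < i")
      case True
      then have "f j + 2 \<le> f i" using i by (auto simp: f_def)
      then show ?thesis by simp
    next
      case False
      then have "f i \<le> f j" using f_step[of i j] that by (cases "i = j") auto
      moreover have "0 < f i" using i by (simp add: f_def)
      ultimately show ?thesis by simp
    qed
    then have "f i - 1 \<notin> D" unfolding D_def image_iff by metis
    moreover have "f i \<in> D" unfolding D_def using i by (intro imageI) simp
    moreover have "2 \<le> f i" using i by (simp add: f_def)
    ultimately show "x \<in> gaps D" using i(3) by (simp add: gaps_def)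
  qed
  then have "card (f ` {m + 1..t}) \<le> card (gaps D)"
    by (intro card_mono finite_gaps finD)
  moreover have "card (f ` {m + 1..t}) = q"
    using t by (subst card_image) (auto intro: inj_on_subset[OF inj])
  moreover have "card {1..p} \<le> card (repeated \<kappa>)"
    using pD finD by (intro card_mono finite_repeated) (auto simp: repeated_def \<kappa>_def count_mset_set')
  ultimately have "t * (t - 1) + (q + p) \<le> partition_degree (tri t + \<nu>) \<kappa>"
    using partition_degree_eq[OF part] set\<kappa> cardD by simp
  then show ?thesis using part by blast
qed

lemma max_degree_eq:
  assumes "t \<ge> 1" "\<nu> \<le> t" "q + p \<le> t" "p \<le> q" "tri q + tri p \<le> \<nu>" "q = 0 \<Longrightarrow> \<nu> = 0"
    "4 * \<nu> < (q + p + 1) * (q + p + 3)"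
  shows "max_degree (tri t + \<nu>) = t * (t - 1) + (q + p)"
proof -
  let ?n = "tri t + \<nu>"
  obtain \<kappa> where \<kappa>: "\<kappa> \<in> partitions ?n" "t * (t - 1) + (q + p) \<le> partition_degree ?n \<kappa>"
    using exists_partition_of_degree[OF assms(1,3,4,5,6)] by auto
  have le: "partition_degree ?n \<mu> \<le> t * (t - 1) + (q + p)" if "\<mu> \<in> partitions ?n" for \<mu>
    using partition_degree_le[OF assms(2,7) that] .
  show ?thesis unfolding max_degree_def
  proof (rule Max_eqI)
    show "finite (partition_degree ?n ` partitions ?n)" using finite_partitions by simp
    show "y \<le> t * (t - 1) + (q + p)" if "y \<in> partition_degree ?n ` partitions ?n" for y
      using that le by auto
    show "t * (t - 1) + (q + p) \<in> partition_degree ?n ` partitions ?n"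
      using \<kappa> le[OF \<kappa>(1)] by (intro image_eqI[of _ _ \<kappa>]) auto
  qed
qed

theorem theorem3p14:
  fixes t \<nu> n q :: nat
  assumes "t \<ge> 1" and "\<nu> \<le> t"
    and "n = t * (t + 1) div 2 + \<nu>"
    and "q = nat \<lfloor>sqrt (real \<nu>)\<rfloor>"
  shows "max_degree n = t * (t - 1) + beta t \<nu> \<and>
         (\<nu> = 0 \<longrightarrow> max_degree n = t * (t - 1)) \<and>
         (q\<^sup>2 \<le> \<nu> \<and> \<nu> < q * (q + 1) \<longrightarrow> max_degree n = t * (t - 1) + 2 * q - 1) \<and>
         (q * (q + 1) \<le> \<nu> \<and> \<nu> < (q + 1)\<^sup>2 \<longrightarrow> max_degree n = t * (t - 1) + 2 * q)"
proof -
  have n: "n = tri t + \<nu>" using assms(3) by (simp add: tri_def)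
  have "real q = real_of_int \<lfloor>sqrt (real \<nu>)\<rfloor>" using assms(4) by simp
  then have "real q \<le> sqrt (real \<nu>)" "sqrt (real \<nu>) < real (q + 1)"
    by linarith+
  then have "real q ^ 2 \<le> real \<nu>" "real \<nu> < real (q + 1) ^ 2"
    using power_mono[of "real q" "sqrt (real \<nu>)" 2]
      power_strict_mono[of "sqrt (real \<nu>)" "real (q + 1)" 2] by simp_all
  then have q_le: "q * q \<le> \<nu>" and q_less: "\<nu> < (q + 1) * (q + 1)"
    unfolding power2_eq_square by (simp_all flip: of_nat_mult del: of_nat_Suc)
  \<comment> \<open>The second component of the balanced pair: \<open>2 T\<^sub>q = q (q + 1)\<close> decides whether \<open>q\<close> fits twice.\<close>
  define p where "p = (if \<nu> < q * (q + 1) then q - 1 else q)"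
  have "q = 0 \<Longrightarrow> \<nu> = 0" using q_less by simp
  moreover have "p \<le> q" by (simp add: p_def)
  moreover have "tri q + tri p \<le> \<nu> \<and> q + p \<le> \<nu> \<and> 4 * \<nu> < (q + p + 1) * (q + p + 3)"
  proof (cases "\<nu> < q * (q + 1)")
    case True
    then obtain s where s: "q = Suc s" by (cases q) auto
    then have p: "p = s" using True by (simp add: p_def)
    have "tri q + tri p \<le> \<nu>" using q_le double_tri[of s] by (simp add: s p)
    moreover have "q + p \<le> \<nu>" using q_le by (simp add: s p)
    moreover have "4 * \<nu> < (q + p + 1) * (q + p + 3)" using True by (simp add: s p algebra_simps)
    ultimately show ?thesis by blast
  next
    case False
    then have p: "p = q" by (simp add: p_def)
    have "tri q + tri p \<le> \<nu>" using False double_tri[of q] by (simp add: p)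
    moreover have "q + p \<le> \<nu>" using False by (cases q) (simp_all add: p)
    moreover have "4 * \<nu> < (q + p + 1) * (q + p + 3)" using q_less by (simp add: p algebra_simps)
    ultimately show ?thesis by blast
  qed
  ultimately have max: "max_degree n = t * (t - 1) + (q + p)" and beta: "beta t \<nu> = q + p"
    using max_degree_eq[of t \<nu> q p] beta_eq[of q t p \<nu>] assms(1,2) n by auto
  have "\<nu> = 0 \<Longrightarrow> q + p = 0" using q_le by (simp add: p_def)
  moreover have "\<nu> < q * (q + 1) \<Longrightarrow> t * (t - 1) + (q + p) = t * (t - 1) + 2 * q - 1"
    by (cases q) (auto simp: p_def)
  moreover have "q * (q + 1) \<le> \<nu> \<Longrightarrow> q + p = 2 * q" by (simp add: p_def)
  ultimately show ?thesis using max beta by auto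
qed

end
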